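(* Let $r$ be a vertex symbol and $\alpha\in\{+,-\}$. Let $\mathcal{A}_\alpha(r)$ be the set of bidirected graphs defined inductively by: (1) every $(-\alpha,-\alpha)$-ditrail that is a simple diear relative to $r$ (i.e., a $(-\alpha,-\alpha)$-ditrail closed over $r$, viewed as a bidirected graph) belongs to $\mathcal{A}_\alpha(r)$; (2) if $G\in\mathcal{A}_\alpha(r)$ and $P$ is a diear relative to $G$ (a diwalk in some bidirected graph having $G$ as a subgraph), then $G+P\in\mathcal{A}_\alpha(r)$. Then $\mathcal{A}_\alpha(r)$ is exactly the set of strong $\alpha$-radials with root $r$.
   Context: A bidirected graph $G$ is a finite graph (loops and parallel edges allowed) with maps $\partial_+,\partial_-:E(G)\to 2^{V(G)}$ such that for each edge $e$ with (possibly identical) ends $u,v$: $\partial_\alpha(e)\subseteq\{u,v\}$, $\partial_+(e)\cup\partial_-(e)=\{u,v\}$, and $\partial_+(e)\cap\partial_-(e)=\emptyset$ if $e$ is not a loop. If $u\in\partial_\alpha(e)$, the sign of $u$ over $e$ is $\alpha$; $-\alpha$ denotes the opposite sign. A walk is a sequence $W=(w_1,\dots,w_k)$, $k$ odd, with $w_i$ a vertex for odd $i$ and $w_i$ an edge joining $w_{i-1},w_{i+1}$ for even $i$; closed over $r$ if $w_1=w_k=r$; a trail has no repeated edge. $W$ is a diwalk if to each traversal of an edge $w_i$ one can assign signs to its end-occurrences equal to the signs of these vertices over $w_i$ (for a loop with one end $+$ and one end $-$, the two assigned signs are distinct), such that at every internal vertex term the signs assigned from the preceding and following edges are distinct. A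 ditrail is a diwalk that is a trail. For $k\ge3$ the sign of $w_1$ (resp. $w_k$) over $W$ is the sign assigned at $w_2$ (resp. $w_{k-1}$); $W$ is an $(\alpha,\beta)$-ditrail if these are $\alpha,\beta$; the trivial ditrail $(v)$ counts as both a $(+,-)$- and a $(-,+)$-ditrail. $G$ is an $\alpha$-radial with root $r$ if every $v$ has an $(\alpha,-\alpha)$-ditrail from $v$ to $r$; it is strong if moreover every $v$ has a $(-\alpha,-\alpha)$-ditrail from $v$ to $r$. For a subgraph $H$, a diear relative to $H$ is a diwalk $W$ whose ends lie in $V(H)$, whose edges are not edges of $H$, and which either (i) is a ditrail (simple diear), or (ii) has the form $(v,e,w_3,\dots,w_{k-2},e,v)$, $k\ge7$, where $e$ joins a vertex of $V(H)$ to a vertex outside $V(H)$ and $(w_3,\dots,w_{k-2})$ is a closed ditrail not containing $e$. A diear relative to $r$ means relative to the graph with the single vertex $r$ and no edges. $H+W$ is $H$ with the vertices and edges of $W$ added. *)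

theory Defs
  imports Main
begin

datatype sign = Plus_sign | Minus_sign

instantiation sign :: uminus
begin

fun uminus_sign :: "sign \<Rightarrow> sign" where
  "- Plus_sign = Minus_sign"
| "- Minus_sign = Plus_sign"

instance ..

end

text \<open>
  A loop is an edge whose set of ends is a singleton. The field \<open>bd\<close> is the family of the
  two maps \<open>\<partial>\<^sub>+\<close> and \<open>\<partial>\<^sub>-\<close>. The values of \<open>ends\<close> and \<open>bd\<close> outside the edge set carry no
  meaning, and none of the notions below depends on them.
\<close>

record ('v, 'e) bigraph =
  verts :: "'v set"
  edges :: "'e set"
  ends :: "'e \<Rightarrow> 'v set"
  bd :: "sign \<Rightarrow> 'e \<Rightarrow> 'v set"

definition bidirected_graph :: "('v, 'e) bigraph \<Rightarrow> bool" where
  "bidirected_graph G \<longleftrightarrow>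
     finite (verts G) \<and> finite (edges G) \<and>
     (\<forall>e\<in>edges G. \<exists>u\<in>verts G. \<exists>v\<in>verts G.
        ends G e = {u, v} \<and>
        (\<forall>\<alpha>. bd G \<alpha> e \<subseteq> {u, v}) \<and>
        bd G Plus_sign e \<union> bd G Minus_sign e = {u, v} \<and>
        (u \<noteq> v \<longrightarrow> bd G Plus_sign e \<inter> bd G Minus_sign e = {}))"

definition subgraph :: "('v, 'e) bigraph \<Rightarrow> ('v, 'e) bigraph \<Rightarrow> bool" where
  "subgraph H G \<longleftrightarrow>
     bidirected_graph H \<and> bidirected_graph G \<and>
     verts H \<subseteq> verts G \<and> edges H \<subseteq> edges G \<and>
     (\<forall>e\<in>edges H. ends H e = ends G e \<and> (\<forall>\<alpha>. bd H \<alpha> e = bd G \<alpha> e))"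

definition point_graph :: "'v \<Rightarrow> ('v, 'e) bigraph" where
  "point_graph r = \<lparr>verts = {r}, edges = {}, ends = (\<lambda>_. {}), bd = (\<lambda>_ _. {})\<rparr>"

text \<open>
  The alternating sequence \<open>(w\<^sub>1, \<dots>, w\<^sub>k)\<close> is split into the list of its vertex terms
  (those at odd positions) and the list of its edge terms (those at even positions).
  Hence \<open>k\<close> is the sum of the two lengths.
\<close>

type_synonym ('v, 'e) walk = "'v list \<times> 'e list"

definition walk_length :: "('v, 'e) walk \<Rightarrow> nat" where
  "walk_length W = length (fst W) + length (snd W)"

definition is_walk :: "('v, 'e) bigraph \<Rightarrow> ('v, 'e) walk \<Rightarrow> bool" where
  "is_walk G W \<longleftrightarrow> (case W of (vs, es) \<Rightarrow>
     length vs = Suc (length es) \<and> set vs \<subseteq> verts G \<and> set es \<subseteq> edges G \<and>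
     (\<forall>i<length es. ends G (es ! i) = {vs ! i, vs ! Suc i}))"

definition walk_from_to :: "'v \<Rightarrow> ('v, 'e) walk \<Rightarrow> 'v \<Rightarrow> bool" where
  "walk_from_to u W v \<longleftrightarrow> hd (fst W) = u \<and> last (fst W) = v"

text \<open>
  For the traversal of the edge \<open>es ! i\<close>, \<open>\<sigma> i\<close> is the sign assigned to the end-occurrence
  \<open>vs ! i\<close> and \<open>\<tau> i\<close> the sign assigned to the end-occurrence \<open>vs ! Suc i\<close>. In a bidirected
  graph \<open>\<partial>\<^sub>+(e)\<close> meets \<open>\<partial>\<^sub>-(e)\<close> only if \<open>e\<close> is a loop with one end \<open>+\<close> and one end \<open>-\<close>.
\<close>

definition diwalk_signs ::
    "('v, 'e) bigraph \<Rightarrow> ('v, 'e) walk \<Rightarrow> (nat \<Rightarrow> sign) \<Rightarrow> (nat \<Rightarrow> sign) \<Rightarrow> bool" where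
  "diwalk_signs G W \<sigma> \<tau> \<longleftrightarrow> (case W of (vs, es) \<Rightarrow>
     (\<forall>i<length es.
        vs ! i \<in> bd G (\<sigma> i) (es ! i) \<and> vs ! Suc i \<in> bd G (\<tau> i) (es ! i) \<and>
        (bd G Plus_sign (es ! i) \<inter> bd G Minus_sign (es ! i) \<noteq> {} \<longrightarrow> \<sigma> i \<noteq> \<tau> i)) \<and>
     (\<forall>i. Suc i < length es \<longrightarrow> \<tau> i \<noteq> \<sigma> (Suc i)))"

definition diwalk :: "('v, 'e) bigraph \<Rightarrow> ('v, 'e) walk \<Rightarrow> bool" where
  "diwalk G W \<longleftrightarrow> is_walk G W \<and> (\<exists>\<sigma> \<tau>. diwalk_signs G W \<sigma> \<tau>)"

definition ditrail :: "('v, 'e) bigraph \<Rightarrow> ('v, 'e) walk \<Rightarrow> bool" where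
  "ditrail G W \<longleftrightarrow> diwalk G W \<and> distinct (snd W)"

text \<open>
  A ditrail through mixed loops can admit several sign assignments, so it can be an
  \<open>(\<alpha>, \<beta>)\<close>-ditrail for more than one pair \<open>(\<alpha>, \<beta>)\<close>.
\<close>

definition signed_ditrail ::
    "('v, 'e) bigraph \<Rightarrow> sign \<Rightarrow> sign \<Rightarrow> ('v, 'e) walk \<Rightarrow> bool" where
  "signed_ditrail G \<alpha> \<beta> W \<longleftrightarrow> ditrail G W \<and>
     (if snd W = [] then \<alpha> \<noteq> \<beta>
      else \<exists>\<sigma> \<tau>. diwalk_signs G W \<sigma> \<tau> \<and> \<sigma> 0 = \<alpha> \<and> \<tau> (length (snd W) - 1) = \<beta>)"

definition radial :: "sign \<Rightarrow> 'v \<Rightarrow> ('v, 'e) bigraph \<Rightarrow> bool" where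
  "radial \<alpha> r G \<longleftrightarrow> bidirected_graph G \<and> r \<in> verts G \<and>
     (\<forall>v\<in>verts G. \<exists>W. signed_ditrail G \<alpha> (- \<alpha>) W \<and> walk_from_to v W r)"

definition strong_radial :: "sign \<Rightarrow> 'v \<Rightarrow> ('v, 'e) bigraph \<Rightarrow> bool" where
  "strong_radial \<alpha> r G \<longleftrightarrow> radial \<alpha> r G \<and>
     (\<forall>v\<in>verts G. \<exists>W. signed_ditrail G (- \<alpha>) (- \<alpha>) W \<and> walk_from_to v W r)"

text \<open>
  In the following definitions \<open>G\<close> is the ambient bidirected graph in which the walk \<open>W\<close>
  lives, and \<open>W\<close> is considered relative to \<open>H\<close>.
\<close>

definition diear_base ::
    "('v, 'e) bigraph \<Rightarrow> ('v, 'e) bigraph \<Rightarrow> ('v, 'e) walk \<Rightarrow> bool" where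
  "diear_base G H W \<longleftrightarrow> diwalk G W \<and>
     hd (fst W) \<in> verts H \<and> last (fst W) \<in> verts H \<and> set (snd W) \<inter> edges H = {}"

definition simple_diear ::
    "('v, 'e) bigraph \<Rightarrow> ('v, 'e) bigraph \<Rightarrow> ('v, 'e) walk \<Rightarrow> bool" where
  "simple_diear G H W \<longleftrightarrow> diear_base G H W \<and> ditrail G W"

definition nonsimple_diear ::
    "('v, 'e) bigraph \<Rightarrow> ('v, 'e) bigraph \<Rightarrow> ('v, 'e) walk \<Rightarrow> bool" where
  "nonsimple_diear G H W \<longleftrightarrow> diear_base G H W \<and> walk_length W \<ge> 7 \<and>
     (\<exists>v e us fs.
        W = (v # us @ [v], e # fs @ [e]) \<and>
        (\<exists>x\<in>verts H. \<exists>y\<in>verts G - verts H. ends G e = {x, y}) \<and>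
        ditrail G (us, fs) \<and> hd us = last us \<and> e \<notin> set fs)"

definition diear ::
    "('v, 'e) bigraph \<Rightarrow> ('v, 'e) bigraph \<Rightarrow> ('v, 'e) walk \<Rightarrow> bool" where
  "diear G H W \<longleftrightarrow> simple_diear G H W \<or> nonsimple_diear G H W"

definition walk_graph :: "('v, 'e) bigraph \<Rightarrow> ('v, 'e) walk \<Rightarrow> ('v, 'e) bigraph" where
  "walk_graph G W = G\<lparr>verts := set (fst W), edges := set (snd W)\<rparr>"

text \<open>
  The graph \<open>H + W\<close>, for a subgraph \<open>H\<close> of \<open>G\<close> and a walk \<open>W\<close> in \<open>G\<close>; it inherits
  incidences and signs from \<open>G\<close>, which agrees with \<open>H\<close> on the edges of \<open>H\<close>.
\<close>

definition add_walk ::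
    "('v, 'e) bigraph \<Rightarrow> ('v, 'e) bigraph \<Rightarrow> ('v, 'e) walk \<Rightarrow> ('v, 'e) bigraph" where
  "add_walk G H W =
     G\<lparr>verts := verts H \<union> set (fst W), edges := edges H \<union> set (snd W)\<rparr>"

inductive_set diear_class :: "sign \<Rightarrow> 'v \<Rightarrow> ('v, 'e) bigraph set"
  for \<alpha> :: sign and r :: 'v where
  base: "\<lbrakk>bidirected_graph K; simple_diear K (point_graph r) W;
          signed_ditrail K (- \<alpha>) (- \<alpha>) W\<rbrakk>
         \<Longrightarrow> walk_graph K W \<in> diear_class \<alpha> r"
| step: "\<lbrakk>G \<in> diear_class \<alpha> r; subgraph G K; diear K G P\<rbrakk>
         \<Longrightarrow> add_walk K G P \<in> diear_class \<alpha> r"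

end

theory Submission
  imports Defs
begin

text \<open>
  Every vertex of a ditrail cuts it into two pieces along which one can leave with either sign
  towards one of the ends, so attaching a diear to a strong radial yields a strong radial.
  Conversely, let \<open>H\<close> be a maximal member of the class inside a strong radial \<open>G\<close>. If \<open>H\<close>
  misses a vertex, some edge \<open>e\<close> leads from \<open>H\<close> to a vertex \<open>y\<close> outside \<open>H\<close>; continue
  from \<open>y\<close>, with the sign opposite to that of \<open>y\<close> over \<open>e\<close>, along a ditrail to the root up
  to its first vertex in \<open>H\<close>. The result is a simple diear, unless the last edge is again \<open>e\<close>,
  and then it is a nonsimple one.
\<close>

section \<open>Signed walks\<close>

text \<open>One traversal of \<open>e\<close> from \<open>u\<close> to \<open>v\<close> with the
  sign \<open>s\<close> assigned at \<open>u\<close> and \<open>t\<close> at \<open>v\<close>. The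
  last conjunct concerns only mixed loops, whose two end-occurrences must receive distinct
  signs.\<close>

definition arc :: "('v, 'e) bigraph \<Rightarrow> 'v \<Rightarrow> sign \<Rightarrow> 'e \<Rightarrow> sign \<Rightarrow> 'v \<Rightarrow> bool" where
  "arc G u s e t v \<longleftrightarrow> u \<in> verts G \<and> v \<in> verts G \<and> e \<in> edges G \<and> ends G e = {u, v} \<and>
     u \<in> bd G s e \<and> v \<in> bd G t e \<and> (bd G Plus_sign e \<inter> bd G Minus_sign e \<noteq> {} \<longrightarrow> s \<noteq> t)"

text \<open>
  The trivial walk has the sign pairs \<open>(s, -s)\<close>, so that concatenation and splitting need no
  special cases.
\<close>

fun swalk :: "('v, 'e) bigraph \<Rightarrow> sign \<Rightarrow> 'v list \<Rightarrow> 'e list \<Rightarrow> sign \<Rightarrow> bool" where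
  "swalk G s [v] [] t \<longleftrightarrow> v \<in> verts G \<and> t = - s"
| "swalk G s (u # v # vs) (e # es) t \<longleftrightarrow> (\<exists>s'. arc G u s e s' v \<and> swalk G (- s') (v # vs) es t)"
| "swalk G s _ _ t \<longleftrightarrow> False"

lemma sign_minus_minus [simp]: "- (- s) = (s :: sign)"
  by (cases s) auto

lemma sign_neq_iff: "s \<noteq> t \<longleftrightarrow> t = - (s :: sign)"
  by (cases s; cases t) auto

lemma arc_verts: "arc G u s e t v \<Longrightarrow> u \<in> verts G \<and> v \<in> verts G"
  by (auto simp: arc_def)

lemma arc_sym: "arc G u s e t v \<Longrightarrow> arc G v t e s u"
  by (auto simp: arc_def)

lemma swalk_append:
  "swalk G s (as @ [v]) es t \<Longrightarrow> swalk G (- t) (v # bs) fs t' \<Longrightarrow> swalk G s (as @ v # bs) (es @ fs) t'"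
proof (induction as arbitrary: s es)
  case Nil
  then show ?case by (cases es) auto
next
  case (Cons a as)
  then show ?case by (cases as; cases es) auto
qed

lemma swalk_split:
  "swalk G s (as @ v # bs) es t \<Longrightarrow>
    \<exists>es1 es2 m. es = es1 @ es2 \<and> swalk G s (as @ [v]) es1 m \<and> swalk G (- m) (v # bs) es2 t"
proof (induction as arbitrary: s es)
  case Nil
  then have "v \<in> verts G" by (cases bs; cases es) (auto simp: arc_def)
  \<comment> \<open>The left piece is the trivial walk at \<open>v\<close>; its sign pair is
    \<open>(s, - s)\<close>, so the sign at the cut is \<open>m = - s\<close> and the right piece is
    the whole walk.\<close>
  with Nil show ?case
    by (intro exI[of _ "[]"] exI[of _ es] exI[of _ "- s"]) auto
next
  case (Cons a as)
  obtain w ws where w: "as @ v # bs = w # ws" by (cases "as @ v # bs") auto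
  with Cons.prems obtain e fs s' where e: "es = e # fs" "arc G a s e s' w"
      "swalk G (- s') (as @ v # bs) fs t"
    by (cases es) auto
  from Cons.IH[OF e(3)] obtain es1 es2 m where
    *: "fs = es1 @ es2" "swalk G (- s') (as @ [v]) es1 m" "swalk G (- m) (v # bs) es2 t"
    by blast
  have "swalk G s ((a # as) @ [v]) (e # es1) m"
    using * e w by (cases as) auto
  with * e show ?case by (metis append_Cons)
qed

lemma swalk_rev: "swalk G s vs es t \<Longrightarrow> swalk G t (rev vs) (rev es) s"
proof (induction G s vs es t rule: swalk.induct)
  case (2 G s u v vs e es t)
  then obtain s' where s': "arc G u s e s' v" "swalk G t (rev vs @ [v]) (rev es) (- s')"
    by auto
  have "swalk G t (rev vs @ v # [u]) (rev es @ [e]) s"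
    using s' by (intro swalk_append[where t = "- s'"]) (auto intro: arc_sym dest: arc_verts)
  then show ?case by simp
qed auto

lemma swalk_length: "swalk G s vs es t \<Longrightarrow> length vs = Suc (length es)"
  by (induction G s vs es t rule: swalk.induct) auto

lemma swalk_nonempty: "swalk G s vs es t \<Longrightarrow> vs \<noteq> []"
  by (auto dest: swalk_length)

lemma swalk_verts: "swalk G s vs es t \<Longrightarrow> set vs \<subseteq> verts G"
  by (induction G s vs es t rule: swalk.induct) (auto simp: arc_def)

lemma swalk_edges: "swalk G s vs es t \<Longrightarrow> set es \<subseteq> edges G"
  by (induction G s vs es t rule: swalk.induct) (auto simp: arc_def)

lemma swalk_ends: "swalk G s vs es t \<Longrightarrow> e \<in> set es \<Longrightarrow> ends G e \<subseteq> set vs"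
  by (induction G s vs es t rule: swalk.induct) (auto simp: arc_def)

text \<open>Signed walks depend only on the incidences and signs of the edges they use. This moves
  them between the ambient graph, a subgraph and the subgraph with a diear added.\<close>

lemma swalk_transfer:
  assumes "swalk G s vs es t" "set vs \<subseteq> verts H" "set es \<subseteq> edges H"
    "\<And>e. e \<in> set es \<Longrightarrow> ends H e = ends G e \<and> (\<forall>\<beta>. bd H \<beta> e = bd G \<beta> e)"
  shows "swalk H s vs es t"
  using assms
proof (induction G s vs es t rule: swalk.induct)
  case (2 G s u v vs e es t)
  then obtain s' where s': "arc G u s e s' v" "swalk G (- s') (v # vs) es t" by auto
  have "swalk H (- s') (v # vs) es t"
    using 2 s' by auto
  moreover have "arc H u s e s' v"
    using 2 s'(1) by (auto simp: arc_def)
  ultimately show ?case by auto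
qed auto

section \<open>Translation between sign functions on indices and signed walks\<close>

lemma is_walk_Cons:
  "is_walk G (u # v # vs, e # es) \<longleftrightarrow>
    u \<in> verts G \<and> e \<in> edges G \<and> ends G e = {u, v} \<and> is_walk G (v # vs, es)"
  by (auto simp: is_walk_def All_less_Suc2)

text \<open>Peeling off the first edge shifts both sign functions by one. The two parts interact
  only at the vertex \<open>v\<close>, and only if another edge follows.\<close>

lemma diwalk_signs_Cons:
  "diwalk_signs G (u # v # vs, e # es) \<sigma> \<tau> \<longleftrightarrow>
    u \<in> bd G (\<sigma> 0) e \<and> v \<in> bd G (\<tau> 0) e \<and>
    (bd G Plus_sign e \<inter> bd G Minus_sign e \<noteq> {} \<longrightarrow> \<sigma> 0 \<noteq> \<tau> 0) \<and>
    (es \<noteq> [] \<longrightarrow> \<sigma> (Suc 0) = - \<tau> 0) \<and>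
    diwalk_signs G (v # vs, es) (\<lambda>i. \<sigma> (Suc i)) (\<lambda>i. \<tau> (Suc i))"
proof -
  have "(\<forall>i. Suc i < length (e # es) \<longrightarrow> \<tau> i \<noteq> \<sigma> (Suc i)) \<longleftrightarrow>
    (es \<noteq> [] \<longrightarrow> \<tau> 0 \<noteq> \<sigma> (Suc 0)) \<and>
    (\<forall>i. Suc i < length es \<longrightarrow> \<tau> (Suc i) \<noteq> \<sigma> (Suc (Suc i)))"
    by (cases es) (simp_all add: All_less_Suc2)
  then show ?thesis
    unfolding diwalk_signs_def prod.case sign_neq_iff
    by (simp only: list.size add_0_right add_Suc_right All_less_Suc2 nth_Cons_0 nth_Cons_Suc
        conj_assoc simp_thms) (simp only: conj_ac)
qed

lemma swalk_imp_signs: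
  "swalk G s vs es t \<Longrightarrow>
    is_walk G (vs, es) \<and> (if es = [] then s \<noteq> t
      else \<exists>\<sigma> \<tau>. diwalk_signs G (vs, es) \<sigma> \<tau> \<and> \<sigma> 0 = s \<and> \<tau> (length es - 1) = t)"
proof (induction G s vs es t rule: swalk.induct)
  case (1 G s v t)
  then show ?case by (cases s) (auto simp: is_walk_def)
next
  case (2 G s u v vs e es t)
  then obtain s' where s': "arc G u s e s' v" "swalk G (- s') (v # vs) es t" by auto
  note IH = "2.IH"[OF s'(2)]
  have w: "is_walk G (u # v # vs, e # es)"
    using IH s'(1) by (auto simp: is_walk_Cons arc_def)
  show ?case
  proof (cases "es = []")
    case True
    with s' have "t = s'" by (cases vs) auto
    with True s'(1) have "diwalk_signs G (u # v # vs, e # es) (\<lambda>_. s) (\<lambda>_. t)"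
      by (auto simp: diwalk_signs_def arc_def)
    with w True show ?thesis by auto
  next
    case False
    with IH obtain \<sigma> \<tau> where *: "diwalk_signs G (v # vs, es) \<sigma> \<tau>" "\<sigma> 0 = - s'"
      "\<tau> (length es - 1) = t" by auto
    \<comment> \<open>\<open>case_nat\<close> puts the signs of the new first edge at index 0 and
      shifts the others up.\<close>
    have "diwalk_signs G (u # v # vs, e # es) (case_nat s \<sigma>) (case_nat s' \<tau>)"
      using False * s'(1) by (simp add: diwalk_signs_Cons arc_def)
    moreover have "case_nat s' \<tau> (length (e # es) - 1) = t"
      using False * by (cases es) auto
    ultimately have "\<exists>\<sigma> \<tau>. diwalk_signs G (u # v # vs, e # es) \<sigma> \<tau> \<and> \<sigma> 0 = s \<and>
        \<tau> (length (e # es) - 1) = t"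
      by (metis old.nat.simps(4))
    with w show ?thesis by (simp only: list.distinct if_False simp_thms)
  qed
qed auto

lemma signs_imp_swalk:
  assumes "is_walk G (vs, es)" "es \<noteq> []" "diwalk_signs G (vs, es) \<sigma> \<tau>"
  shows "swalk G (\<sigma> 0) vs es (\<tau> (length es - 1))"
  using assms
proof (induction es arbitrary: vs \<sigma> \<tau>)
  case (Cons e es)
  obtain u v ws where vs: "vs = u # v # ws"
    using Cons.prems(1) by (cases vs; cases "tl vs") (auto simp: is_walk_def)
  have a: "arc G u (\<sigma> 0) e (\<tau> 0) v"
    using Cons.prems(1,3) unfolding vs is_walk_Cons diwalk_signs_Cons
    by (cases ws) (auto simp: arc_def is_walk_def)
  have w: "is_walk G (v # ws, es)"
    using Cons.prems(1) by (simp add: vs is_walk_Cons)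
  show ?case
  proof (cases "es = []")
    case True
    with w have "ws = []" by (auto simp: is_walk_def)
    with True a vs show ?thesis by (auto dest: arc_verts)
  next
    case False
    have "diwalk_signs G (v # ws, es) (\<lambda>i. \<sigma> (Suc i)) (\<lambda>i. \<tau> (Suc i))"
      using Cons.prems(3) by (simp add: vs diwalk_signs_Cons)
    from Cons.IH[OF w False this] have "swalk G (\<sigma> (Suc 0)) (v # ws) es (\<tau> (length es))"
      using False by simp
    moreover have "\<sigma> (Suc 0) = - \<tau> 0"
      using Cons.prems(3) False by (simp add: vs diwalk_signs_Cons)
    ultimately show ?thesis using a vs by auto
  qed
qed simp

text \<open>In the trivial case \<open>signed_ditrail\<close> asks for distinct signs, which is the
  convention \<open>t = - s\<close> of \<open>swalk\<close>; otherwise the sign functions are read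
  off edge by edge.\<close>

lemma signed_ditrail_iff:
  "signed_ditrail G a b (vs, es) \<longleftrightarrow> swalk G a vs es b \<and> distinct es"
proof
  assume l: "signed_ditrail G a b (vs, es)"
  show "swalk G a vs es b \<and> distinct es"
  proof (cases "es = []")
    case True
    with l obtain v where "vs = [v]"
      by (cases vs) (auto simp: signed_ditrail_def ditrail_def diwalk_def is_walk_def)
    with l True show ?thesis
      by (auto simp: signed_ditrail_def ditrail_def diwalk_def is_walk_def sign_neq_iff)
  next
    case False
    with l show ?thesis
      using signs_imp_swalk[of G vs es] by (auto simp: signed_ditrail_def ditrail_def diwalk_def)
  qed
next
  assume r: "swalk G a vs es b \<and> distinct es"
  then show "signed_ditrail G a b (vs, es)"
    using swalk_imp_signs[of G a vs es b]
    by (auto simp: signed_ditrail_def ditrail_def diwalk_def diwalk_signs_def split: if_splits)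
qed

lemma diwalk_iff: "diwalk G (vs, es) \<longleftrightarrow> (\<exists>a b. swalk G a vs es b)"
proof
  assume l: "diwalk G (vs, es)"
  show "\<exists>a b. swalk G a vs es b"
  proof (cases "es = []")
    case True
    \<comment> \<open>A trivial diwalk carries no signs of its own, so the pair (+, -) is chosen for
      it.\<close>
    with l have "signed_ditrail G Plus_sign Minus_sign (vs, es)"
      by (auto simp: signed_ditrail_def ditrail_def)
    then show ?thesis by (auto simp: signed_ditrail_iff)
  next
    case False
    with l show ?thesis using signs_imp_swalk[of G vs es] by (auto simp: diwalk_def)
  qed
next
  assume "\<exists>a b. swalk G a vs es b"
  then obtain a b where "swalk G a vs es b" by blast
  then show "diwalk G (vs, es)"
    using swalk_imp_signs[of G a vs es b] by (auto simp: diwalk_def diwalk_signs_def split: if_splits)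
qed

section \<open>Strong radials\<close>

text \<open>The ditrails demanded by \<open>radial\<close> and by strongness all arrive at
  \<open>r\<close> with sign \<open>- \<alpha>\<close> and start with \<open>\<alpha>\<close> and
  \<open>- \<alpha>\<close>, which are all the signs. Hence the starting sign can be prescribed
  freely.\<close>

lemma strong_radial_iff:
  "strong_radial \<alpha> r G \<longleftrightarrow> bidirected_graph G \<and> r \<in> verts G \<and>
    (\<forall>v\<in>verts G. \<forall>s. \<exists>vs es. swalk G s vs es (- \<alpha>) \<and> distinct es \<and> hd vs = v \<and> last vs = r)"
  (is "?L \<longleftrightarrow> ?R")
proof -
  have all_sign: "(\<forall>s. P s) \<longleftrightarrow> P \<alpha> \<and> P (- \<alpha>)" for P
    by (metis sign_neq_iff)
  show ?thesis
    by (subst all_sign)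
      (auto simp: strong_radial_def radial_def split_paired_Ex signed_ditrail_iff walk_from_to_def)
qed

lemma strong_radial_trail:
  assumes "strong_radial \<alpha> r G" "v \<in> verts G"
  obtains ws es where "swalk G s (v # ws) es (- \<alpha>)" "distinct es" "last (v # ws) = r"
proof -
  from assms obtain vs es where "swalk G s vs es (- \<alpha>)" "distinct es" "hd vs = v" "last vs = r"
    unfolding strong_radial_iff by blast
  with that show thesis by (cases vs) auto
qed

section \<open>Members of the class are strong radials\<close>

lemma bidirected_graph_restrict:
  assumes "bidirected_graph K" "V \<subseteq> verts K" "E \<subseteq> edges K" "\<And>e. e \<in> E \<Longrightarrow> ends K e \<subseteq> V"
  shows "bidirected_graph (K\<lparr>verts := V, edges := E\<rparr>)"
proof -
  have "\<exists>u\<in>V. \<exists>v\<in>V. ends K e = {u, v} \<and> (\<forall>\<beta>. bd K \<beta> e \<subseteq> {u, v}) \<and>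
      bd K Plus_sign e \<union> bd K Minus_sign e = {u, v} \<and>
      (u \<noteq> v \<longrightarrow> bd K Plus_sign e \<inter> bd K Minus_sign e = {})" if "e \<in> E" for e
  proof -
    from that assms obtain u v where uv: "ends K e = {u, v} \<and> (\<forall>\<beta>. bd K \<beta> e \<subseteq> {u, v}) \<and>
      bd K Plus_sign e \<union> bd K Minus_sign e = {u, v} \<and>
      (u \<noteq> v \<longrightarrow> bd K Plus_sign e \<inter> bd K Minus_sign e = {})"
      unfolding bidirected_graph_def by blast
    moreover from uv assms(4)[OF that] have "u \<in> V" "v \<in> V" by auto
    ultimately show ?thesis by blast
  qed
  then show ?thesis
    using assms by (auto simp: bidirected_graph_def intro: finite_subset)
qed

lemma bidirected_graph_endsD:
  assumes "bidirected_graph G" "e \<in> edges G"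
  shows "ends G e \<subseteq> verts G"
  using assms unfolding bidirected_graph_def by fastforce

text \<open>Cut the ditrail at an occurrence of \<open>v\<close>. The reversed first piece leaves
  \<open>v\<close> with the sign \<open>m\<close> and the second with \<open>- m\<close>, so one of
  them starts with the prescribed sign \<open>s\<close>.\<close>

lemma swalk_escape:
  assumes "swalk K a vs es b" "distinct es" "v \<in> set vs"
  obtains vs' es' t where "swalk K s vs' es' t" "distinct es'" "hd vs' = v"
    "set vs' \<subseteq> set vs" "set es' \<subseteq> set es"
    "last vs' = hd vs \<and> t = a \<or> last vs' = last vs \<and> t = b"
proof -
  obtain as bs where vs: "vs = as @ v # bs" using assms(3) by (meson split_list)
  with swalk_split assms(1) obtain es1 es2 m where
    *: "es = es1 @ es2" "swalk K a (as @ [v]) es1 m" "swalk K (- m) (v # bs) es2 b"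
    by metis
  show thesis
  proof (cases "s = m")
    case True
    have "swalk K s (v # rev as) (rev es1) a"
      using swalk_rev[OF *(2)] True by simp
    moreover have "last (v # rev as) = hd vs" using vs by (cases as) auto
    ultimately show ?thesis
      using that[of "v # rev as" "rev es1" a] * assms(2) vs by auto
  next
    case False
    then have "s = - m" by (metis sign_neq_iff)
    then show ?thesis using that[of "v # bs" es2 b] * assms(2) vs by auto
  qed
qed

text \<open>Both ends of the ditrail are \<open>r\<close> with sign \<open>- \<alpha>\<close>, so it
  does not matter which end the escape from a vertex reaches.\<close>

lemma walk_graph_strong_radial:
  assumes "bidirected_graph K" "simple_diear K (point_graph r) W"
    "signed_ditrail K (- \<alpha>) (- \<alpha>) W"
  shows "strong_radial \<alpha> r (walk_graph K W)"
proof -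
  obtain vs es where W: "W = (vs, es)" by (cases W)
  have sw: "swalk K (- \<alpha>) vs es (- \<alpha>)" "distinct es"
    using assms(3) by (auto simp: W signed_ditrail_iff)
  have r: "hd vs = r" "last vs = r"
    using assms(2) by (auto simp: W simple_diear_def diear_base_def point_graph_def)
  have bi: "bidirected_graph (walk_graph K W)"
    unfolding walk_graph_def W using sw
    by (intro bidirected_graph_restrict assms(1))
      (auto dest: swalk_verts swalk_edges swalk_ends)
  have "r \<in> set vs" using r swalk_nonempty[OF sw(1)] by auto
  moreover have "\<exists>vs' es'. swalk (walk_graph K W) s vs' es' (- \<alpha>) \<and> distinct es' \<and>
      hd vs' = v \<and> last vs' = r" if v: "v \<in> set vs" for v s
  proof -
    obtain vs' es' t where *: "swalk K s vs' es' t" "distinct es'" "hd vs' = v"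
      "set vs' \<subseteq> set vs" "set es' \<subseteq> set es"
      "last vs' = hd vs \<and> t = - \<alpha> \<or> last vs' = last vs \<and> t = - \<alpha>"
      using swalk_escape[OF sw v] by metis
    have "swalk (walk_graph K W) s vs' es' t"
      using *(4,5) by (intro swalk_transfer[OF *(1)]) (auto simp: walk_graph_def W)
    with * r show ?thesis by auto
  qed
  ultimately show ?thesis
    using bi unfolding strong_radial_iff by (auto simp: walk_graph_def W)
qed

text \<open>For a simple diear, escape along the ditrail itself. For a nonsimple one, escape inside
  its closed ditrail to the outer end \<open>c\<close> of \<open>e\<close>, then use
  \<open>e\<close> once to enter \<open>H\<close>.\<close>

lemma diear_escape:
  assumes K: "bidirected_graph K" and P: "diear K H (vs, es)" and v: "v \<in> set vs" "v \<notin> verts H"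
  obtains vs' es' t where "swalk K s vs' es' t" "distinct es'" "hd vs' = v" "last vs' \<in> verts H"
    "set vs' \<subseteq> set vs" "set es' \<subseteq> set es"
proof (cases "simple_diear K H (vs, es)")
  case True
  then obtain a b where ab: "swalk K a vs es b" "distinct es" "hd vs \<in> verts H" "last vs \<in> verts H"
    by (auto simp: simple_diear_def diear_base_def ditrail_def diwalk_iff)
  from swalk_escape[OF ab(1,2) v(1)] that ab(3,4) show ?thesis by metis
next
  case False
  with P have ns: "nonsimple_diear K H (vs, es)" by (auto simp: diear_def)
  then obtain z e us fs x y where
    W: "vs = z # us @ [z]" "es = e # fs @ [e]"
    and xy: "x \<in> verts H" "y \<notin> verts H" "ends K e = {x, y}"
    and us: "ditrail K (us, fs)" "hd us = last us" "e \<notin> set fs"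
    unfolding nonsimple_diear_def by auto
  have z: "z \<in> verts H" using ns by (auto simp: nonsimple_diear_def diear_base_def W)
  obtain a b where ab: "swalk K a vs es b"
    using ns by (auto simp: nonsimple_diear_def diear_base_def diwalk_iff)
  have "us \<noteq> []" using us(1) by (auto simp: ditrail_def diwalk_def is_walk_def)
  then obtain ws c where c: "us = ws @ [c]" by (metis rev_exhaust)
  obtain ws' where c': "us = c # ws'" using us(2) c by (metis last_snoc list.collapse snoc_eq_iff_butlast)
  obtain g where g: "arc K z a e g c" "swalk K (- g) (ws @ c # [z]) (fs @ [e]) b"
    using ab unfolding W c' by (metis append_Cons append_assoc append_Nil c c' swalk.simps(2))
  obtain es1 es2 m where s: "fs @ [e] = es1 @ es2" "swalk K (- g) us es1 m"
      "swalk K (- m) [c, z] es2 b"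
    using swalk_split[OF g(2)] c by auto
  then obtain f where "es2 = [f]" using swalk_length[OF s(3)] by (cases es2) auto
  with s have s': "swalk K (- g) us fs m" "arc K c (- m) e b z" by auto
  \<comment> \<open>Exactly one end of \<open>e\<close> lies in \<open>H\<close>, so
    \<open>e\<close> is no loop and \<open>c\<close> has a single sign over it. The sign
    \<open>g\<close> on arrival therefore equals the sign \<open>- m\<close> on departure, and the
    closed ditrail has sign \<open>- g\<close> at both ends.\<close>
  have cz: "c \<noteq> z" using g(1) xy z by (auto simp: arc_def doubleton_eq_iff)
  have dis: "bd K Plus_sign e \<inter> bd K Minus_sign e = {}"
  proof -
    have "e \<in> edges K" "ends K e = {z, c}" using g(1) by (auto simp: arc_def)
    with K cz show ?thesis
      unfolding bidirected_graph_def by (metis doubleton_eq_iff)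
  qed
  have "- m = g"
    using g(1) s'(2) dis by (cases m; cases g) (auto simp: arc_def)
  then have m: "m = - g" by auto
  have vus: "v \<in> set us" using v z W by auto
  have dfs: "distinct fs" using us(1) by (auto simp: ditrail_def)
  \<comment> \<open>Either end of the closed ditrail is \<open>c\<close> with sign
    \<open>- g\<close>, so \<open>e\<close> can follow the escape in both cases.\<close>
  obtain vs' es' where *: "swalk K s vs' es' (- g)" "distinct es'" "hd vs' = v"
    "set vs' \<subseteq> set us" "set es' \<subseteq> set fs" "last vs' = c"
    using swalk_escape[OF s'(1) dfs vus, of s] c us(2) m by (metis last_snoc)
  obtain xs where xs: "vs' = xs @ [c]"
    using *(6) swalk_nonempty[OF *(1)] by (metis append_butlast_last_id)
  have "swalk K s (xs @ c # [z]) (es' @ [e]) b"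
    using * s'(2) m xs by (intro swalk_append[where t = "- g"]) (auto dest: arc_verts)
  moreover have "hd (xs @ c # [z]) = v" using *(3) xs by (cases xs) auto
  ultimately show ?thesis
    using that[of "xs @ c # [z]" "es' @ [e]" b] * xs z us(3) W c by auto
qed

text \<open>From a new vertex, escape along the diear to some \<open>c\<close> in \<open>H\<close>,
  then continue to \<open>r\<close> inside \<open>H\<close>, starting with the sign opposite to that
  of the arrival. No edge is repeated because the edges of the diear are not in
  \<open>H\<close>.\<close>

lemma add_walk_strong_radial:
  assumes H: "strong_radial \<alpha> r H" and sub: "subgraph H K" and P: "diear K H P"
  shows "strong_radial \<alpha> r (add_walk K H P)"
proof -
  obtain vs es where W: "P = (vs, es)" by (cases P)
  have K: "bidirected_graph K" and bH: "bidirected_graph H" using sub by (auto simp: subgraph_def)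
  have base: "diear_base K H (vs, es)"
    using P by (auto simp: W diear_def simple_diear_def nonsimple_diear_def)
  then obtain a b where sw: "swalk K a vs es b" and new: "set es \<inter> edges H = {}"
    by (auto simp: diear_base_def diwalk_iff)
  let ?A = "add_walk K H P"
  have bi: "bidirected_graph ?A"
    unfolding add_walk_def W
  proof (rule bidirected_graph_restrict[OF K])
    fix e assume "e \<in> edges H \<union> set (snd (vs, es))"
    moreover have "ends K e \<subseteq> verts H" if "e \<in> edges H"
      using bidirected_graph_endsD[OF bH that] sub that by (auto simp: subgraph_def)
    ultimately show "ends K e \<subseteq> verts H \<union> set (fst (vs, es))"
      using swalk_ends[OF sw] by auto
  qed (use sub swalk_verts[OF sw] swalk_edges[OF sw] in \<open>auto simp: subgraph_def\<close>)
  have fromH: "swalk ?A s vs' es' t" if "swalk H s vs' es' t" for s vs' es' t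
    using swalk_verts[OF that] swalk_edges[OF that] sub
    by (intro swalk_transfer[OF that]) (auto simp: add_walk_def subgraph_def)
  have "\<exists>vs es. swalk ?A s vs es (- \<alpha>) \<and> distinct es \<and> hd vs = v \<and> last vs = r"
    if v: "v \<in> verts ?A" for v s
  proof (cases "v \<in> verts H")
    case True
    then show ?thesis using H fromH unfolding strong_radial_iff by blast
  next
    case False
    with v have "v \<in> set vs" by (auto simp: add_walk_def W)
    then obtain vs' es' t where *: "swalk K s vs' es' t" "distinct es'" "hd vs' = v"
      "last vs' \<in> verts H" "set vs' \<subseteq> set vs" "set es' \<subseteq> set es"
      using diear_escape[OF K P[unfolded W] _ False] by metis
    have 1: "swalk ?A s vs' es' t"
      using * by (intro swalk_transfer[OF *(1)]) (auto simp: add_walk_def W)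
    obtain xs c where xs: "vs' = xs @ [c]"
      using swalk_nonempty[OF *(1)] by (metis rev_exhaust)
    then have "c \<in> verts H" using *(4) by simp
    then obtain ws fs where 2: "swalk H (- t) (c # ws) fs (- \<alpha>)" "distinct fs" "last (c # ws) = r"
      using strong_radial_trail[OF H] by blast
    have "swalk ?A s (xs @ c # ws) (es' @ fs) (- \<alpha>)"
      using swalk_append 1 fromH[OF 2(1)] xs by metis
    moreover have "distinct (es' @ fs)"
      using *(2,6) 2 swalk_edges[OF 2(1)] new by auto
    moreover have "hd (xs @ c # ws) = v" using *(3) xs by (cases xs) auto
    ultimately show ?thesis using 2(3) by (metis last_append list.distinct(1))
  qed
  moreover have "r \<in> verts ?A" using H by (auto simp: strong_radial_iff add_walk_def)
  ultimately show ?thesis using bi unfolding strong_radial_iff by blast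
qed

lemma diear_class_strong_radial: "G \<in> diear_class \<alpha> r \<Longrightarrow> strong_radial \<alpha> r G"
  by (induction rule: diear_class.induct)
    (auto intro: walk_graph_strong_radial add_walk_strong_radial)

section \<open>Existence of diears\<close>

text \<open>Cut at the first vertex \<open>z\<close> in \<open>V\<close>; it has a predecessor
  \<open>c\<close> because the walk starts outside \<open>V\<close>. The edge \<open>f\<close> of
  entry is split off, so that all edges of \<open>fs\<close> have their ends outside
  \<open>V\<close>.\<close>

lemma swalk_first_entry:
  assumes "swalk G s vs es t" "distinct es" "hd vs \<notin> V" "last vs \<in> V"
  obtains as c z fs f m n where "swalk G s (as @ [c]) fs m" "arc G c (- m) f n z"
    "hd (as @ [c]) = hd vs" "set (as @ [c]) \<inter> V = {}" "z \<in> V" "distinct (fs @ [f])"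
proof -
  have "\<exists>x\<in>set vs. x \<in> V" using assms(4) swalk_nonempty[OF assms(1)] last_in_set by blast
  then obtain bs z cs where vs: "vs = bs @ z # cs" "z \<in> V" "\<forall>y\<in>set bs. y \<notin> V"
    using split_list_first_prop[of vs "\<lambda>x. x \<in> V"] by blast
  have "bs \<noteq> []" using assms(3) vs by auto
  then obtain as c where bs: "bs = as @ [c]" by (metis rev_exhaust)
  obtain es1 es2 n where 1: "es = es1 @ es2" "swalk G s (as @ c # [z]) es1 n"
    using swalk_split[of G s bs z cs es t] assms(1) vs(1) bs by auto
  obtain fs gs m where 2: "es1 = fs @ gs" "swalk G s (as @ [c]) fs m" "swalk G (- m) [c, z] gs n"
    using swalk_split[OF 1(2)] by blast
  from 2(3) obtain f where gs: "gs = [f]" using swalk_length[OF 2(3)] by (cases gs) auto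
  have "hd (as @ [c]) = hd vs" using vs(1) bs by (cases as) auto
  then show thesis
    using that[of as c fs m f n z] 1 2 gs vs bs assms(2) by auto
qed

text \<open>
  The diear enters along an edge that joins \<open>H\<close> to an outside vertex \<open>y\<close>. The edge cannot be
  traversed again before the return to \<open>H\<close>, and if it is the edge of return, then the part in
  between is a closed ditrail over \<open>y\<close>; it is nontrivial because of the signs at \<open>y\<close>.
\<close>

lemma diear_exists:
  assumes G: "strong_radial \<alpha> r G" and H: "subgraph H G" "r \<in> verts H"
    and ne: "w \<in> verts G" "w \<notin> verts H"
  obtains P where "diear G H P" "\<not> set (snd P) \<subseteq> edges H"
proof -
  have bG: "bidirected_graph G" and bH: "bidirected_graph H" using H by (auto simp: subgraph_def)
  have endsH: "ends G e \<subseteq> verts H" if "e \<in> edges H" for e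
    using bidirected_graph_endsD[OF bH that] H that by (auto simp: subgraph_def)
  \<comment> \<open>This ditrail serves only to find an edge \<open>e\<close> that crosses into
    \<open>H\<close>; its starting sign is arbitrary.\<close>
  obtain ws ds where "swalk G \<alpha> (w # ws) ds (- \<alpha>)" "distinct ds" "last (w # ws) = r"
    using strong_radial_trail[OF G ne(1)] by blast
  with swalk_first_entry[of G \<alpha> "w # ws" ds "- \<alpha>" "verts H"] ne H(2)
  obtain as y x e g h where "arc G y g e h x" "set (as @ [y]) \<inter> verts H = {}" "x \<in> verts H"
    by (metis list.sel(1))
  then have e: "arc G y g e h x" and y: "y \<notin> verts H" and x: "x \<in> verts H" by auto
  have eG: "e \<in> edges G" "ends G e = {y, x}" "y \<in> verts G" using e by (auto simp: arc_def)
  have eH: "e \<notin> edges H" using endsH eG y by auto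
  obtain zs es where "swalk G (- g) (y # zs) es (- \<alpha>)" "distinct es" "last (y # zs) = r"
    using strong_radial_trail[OF G eG(3)] by blast
  with swalk_first_entry[of G "- g" "y # zs" es "- \<alpha>" "verts H"] y H(2)
  obtain as c z fs f m n where t: "swalk G (- g) (as @ [c]) fs m" "arc G c (- m) f n z"
    "hd (as @ [c]) = y" "set (as @ [c]) \<inter> verts H = {}" "z \<in> verts H" "distinct (fs @ [f])"
    by (metis list.sel(1))
  obtain us where us: "as @ [c] = y # us" using t(3) by (cases as) auto
  let ?P = "(x # as @ [c, z], e # fs @ [f])"
  have "swalk G (- g) (as @ c # [z]) (fs @ [f]) n"
    using t(1,2) by (intro swalk_append) (auto dest: arc_verts)
  then have "swalk G (- g) (y # us @ [z]) (fs @ [f]) n" using us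
    by (metis append_Cons append_assoc append_Nil)
  then have "swalk G h (x # y # us @ [z]) (e # fs @ [f]) n"
    using arc_sym[OF e] by auto
  then have P: "swalk G h (x # as @ [c, z]) (e # fs @ [f]) n"
    using us by (metis append_Cons append_assoc append_Nil)
  \<comment> \<open>The ends of \<open>p\<close> lie outside \<open>H\<close>, while edges of
    \<open>H\<close> have theirs inside; these contradict each other only because the set of ends is
    nonempty.\<close>
  have fs: "p \<notin> edges H \<and> x \<notin> ends G p" if "p \<in> set fs" for p
  proof -
    have "ends G p \<subseteq> set (as @ [c])" using swalk_ends[OF t(1) that] .
    moreover have "p \<in> edges G" using swalk_edges[OF t(1)] that by auto
    then have "\<exists>u v. ends G p = {u, v}" using bG unfolding bidirected_graph_def by blast
    then have "ends G p \<noteq> {}" by auto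
    ultimately show ?thesis using endsH[of p] t(4) x by auto
  qed
  have "f \<notin> edges H" using endsH[of f] t(2,4) by (auto simp: arc_def)
  with fs eH have "set (snd ?P) \<inter> edges H = {}" by auto
  with P x t(5) have base: "diear_base G H ?P"
    by (auto simp: diear_base_def diwalk_iff)
  have efs: "e \<notin> set fs" using fs eG by auto
  have "diear G H ?P"
  proof (cases "f = e")
    case False
    then have "distinct (e # fs @ [f])" using efs t(6) by auto
    with base show ?thesis by (auto simp: diear_def simple_diear_def ditrail_def diear_base_def)
  next
    case True
    with t(2) eG have "{c, z} = {y, x}" by (auto simp: arc_def)
    with y x t(4,5) have cz: "c = y" "z = x" by (auto simp: doubleton_eq_iff)
    have "fs \<noteq> []"
    proof
      assume "fs = []"
      with t(1) have "m = g" using swalk_length[OF t(1)] by auto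
      then have "y \<in> bd G (- g) e" "y \<in> bd G g e" using t(2) e True cz by (auto simp: arc_def)
      then have "bd G Plus_sign e \<inter> bd G Minus_sign e \<noteq> {}" by (cases g) auto
      moreover have "y \<noteq> x" using x y by auto
      ultimately show False
        using bG eG unfolding bidirected_graph_def by (metis doubleton_eq_iff)
    qed
    \<comment> \<open>With at least one edge in \<open>fs\<close>, the walk has at least 3 edges and
      4 vertex terms.\<close>
    then have "walk_length ?P \<ge> 7"
      using swalk_length[OF t(1)] by (cases fs) (auto simp: walk_length_def)
    moreover have "ditrail G (as @ [c], fs)"
      using t(1,6) by (auto simp: ditrail_def diwalk_iff)
    moreover have "?P = (x # (as @ [c]) @ [x], e # fs @ [e])" using True cz by simp
    moreover have "hd (as @ [c]) = last (as @ [c])" using t(3) cz by simp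
    moreover have "\<exists>x\<in>verts H. \<exists>y\<in>verts G - verts H. ends G e = {x, y}"
      using x y eG by blast
    ultimately have "nonsimple_diear G H ?P"
      unfolding nonsimple_diear_def using base efs by blast
    then show ?thesis by (simp add: diear_def)
  qed
  with that[of ?P] eH show thesis by auto
qed

text \<open>Once \<open>H\<close> contains all vertices, a missing edge is by itself a simple diear.
  Its ends get any signs they have over \<open>e\<close>, except that on a mixed loop the two signs
  are chosen distinct.\<close>

lemma edge_diear:
  assumes G: "bidirected_graph G" and H: "verts H = verts G" and e: "e \<in> edges G" "e \<notin> edges H"
  obtains P where "diear G H P" "\<not> set (snd P) \<subseteq> edges H"
proof -
  obtain u v where uv: "u \<in> verts G" "v \<in> verts G" "ends G e = {u, v}"
      "bd G Plus_sign e \<union> bd G Minus_sign e = {u, v}" "\<forall>\<beta>. bd G \<beta> e \<subseteq> {u, v}"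
      "u \<noteq> v \<longrightarrow> bd G Plus_sign e \<inter> bd G Minus_sign e = {}"
    using G e unfolding bidirected_graph_def by blast
  have ex: "\<exists>s. p \<in> bd G s e" if "p \<in> {u, v}" for p
    using uv(4) that by blast
  have "\<exists>s t. arc G u s e t v"
  proof (cases "bd G Plus_sign e \<inter> bd G Minus_sign e = {}")
    case True
    then show ?thesis using ex[of u] ex[of v] uv e by (auto simp: arc_def)
  next
    case False
    then have "arc G u Plus_sign e Minus_sign v" using uv e by (auto simp: arc_def)
    then show ?thesis by blast
  qed
  then have "diwalk G ([u, v], [e])" by (auto simp: diwalk_iff dest: arc_verts)
  then have "diear G H ([u, v], [e])"
    using uv H e by (auto simp: diear_def simple_diear_def diear_base_def ditrail_def)
  then show thesis using that e by auto
qed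

section \<open>Strong radials belong to the class\<close>

lemma strong_radial_diear_class:
  assumes G: "strong_radial \<alpha> r G"
  shows "G \<in> diear_class \<alpha> r"
proof -
  have bG: "bidirected_graph G" and rG: "r \<in> verts G" using G by (auto simp: strong_radial_iff)
  have fin: "finite (edges G)" using bG by (auto simp: bidirected_graph_def)
  \<comment> \<open>Maximality is taken over edge sets alone, since every diear to be added
    contributes a new edge. The members keep the fields \<open>ends\<close> and \<open>bd\<close> of
    \<open>G\<close>, so the one with all vertices and edges is literally \<open>G\<close>.\<close>
  define S where "S = {E. E \<subseteq> edges G \<and>
    (\<exists>V\<subseteq>verts G. G\<lparr>verts := V, edges := E\<rparr> \<in> diear_class \<alpha> r)}"
  have finS: "finite S" using fin by (auto simp: S_def intro: finite_subset[of _ "Pow (edges G)"])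
  \<comment> \<open>Strongness at the root itself provides the closed ditrail for the base case, so
    \<open>S\<close> is nonempty.\<close>
  obtain ws es where w: "swalk G (- \<alpha>) (r # ws) es (- \<alpha>)" "distinct es" "last (r # ws) = r"
    using strong_radial_trail[OF G rG] by blast
  then have "signed_ditrail G (- \<alpha>) (- \<alpha>) (r # ws, es)" by (simp add: signed_ditrail_iff)
  moreover from this w(3) have "simple_diear G (point_graph r) (r # ws, es)"
    by (auto simp: simple_diear_def diear_base_def point_graph_def signed_ditrail_def ditrail_def)
  ultimately have "walk_graph G (r # ws, es) \<in> diear_class \<alpha> r"
    using bG by (intro diear_class.base)
  then have "set es \<in> S"
    using swalk_verts[OF w(1)] swalk_edges[OF w(1)] by (auto simp: S_def walk_graph_def intro!: exI[of _ "set (r # ws)"])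
  then obtain E where E: "E \<in> S" "\<forall>F\<in>S. E \<subseteq> F \<longrightarrow> E = F"
    using finite_has_maximal[OF finS] by auto
  then obtain V where V: "V \<subseteq> verts G" "E \<subseteq> edges G"
    and mem: "G\<lparr>verts := V, edges := E\<rparr> \<in> diear_class \<alpha> r" by (auto simp: S_def)
  let ?H = "G\<lparr>verts := V, edges := E\<rparr>"
  have srH: "strong_radial \<alpha> r ?H" using diear_class_strong_radial[OF mem] .
  then have sub: "subgraph ?H G" and rH: "r \<in> verts ?H"
    using bG V by (auto simp: subgraph_def strong_radial_iff)
  \<comment> \<open>Adding a diear stays in the class and inside \<open>G\<close>, so by maximality
    it brings no new edge. The two cases below contradict this by exhibiting a diear with
    one.\<close>
  have no: "set (snd P) \<subseteq> E" if P: "diear G ?H P" for P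
  proof -
    obtain vs ps where W: "P = (vs, ps)" by (cases P)
    have "diwalk G (vs, ps)"
      using P by (auto simp: W diear_def simple_diear_def nonsimple_diear_def diear_base_def)
    then have "set vs \<subseteq> verts G" "set ps \<subseteq> edges G"
      by (auto simp: diwalk_def is_walk_def)
    moreover have "add_walk G ?H P \<in> diear_class \<alpha> r" using mem sub P by (rule diear_class.step)
    ultimately have "E \<union> set ps \<in> S"
      using V by (auto simp: S_def add_walk_def W intro!: exI[of _ "V \<union> set vs"])
    with E(2) W show ?thesis by auto
  qed
  have 1: "V = verts G"
  proof (rule ccontr)
    assume "V \<noteq> verts G"
    with V obtain w where "w \<in> verts G" "w \<notin> verts ?H" by auto
    with diear_exists[OF G sub rH] obtain P where "diear G ?H P" "\<not> set (snd P) \<subseteq> edges ?H"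
      by metis
    with no show False by simp
  qed
  moreover have "E = edges G"
  proof (rule ccontr)
    assume "E \<noteq> edges G"
    with V obtain e where "e \<in> edges G" "e \<notin> edges ?H" by auto
    moreover have "verts ?H = verts G" using 1 by simp
    ultimately obtain P where "diear G ?H P" "\<not> set (snd P) \<subseteq> edges ?H"
      using edge_diear[OF bG] by metis
    with no show False by simp
  qed
  ultimately show ?thesis using mem by simp
qed

theorem theorem9p4:
  fixes r :: 'v and \<alpha> :: sign
  shows "(diear_class \<alpha> r :: ('v, 'e) bigraph set) = {G. strong_radial \<alpha> r G}"
  by (auto intro: diear_class_strong_radial strong_radial_diear_class)

end
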